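(* Let $I$ be an index set and $\mathcal F$ an ultrafilter on $I$. For each $i\in I$ let $\mathbf X_i=\langle X_i,\le_i\rangle$ be a poset with $X_i\ne\varnothing$, $E_i$ an equivalence relation on $X_i$ with ${\le_i}\subseteq E_i$, and $\alpha_i:X_i\to X_i$ an order automorphism of $\mathbf X_i$ with $\alpha_i\subseteq E_i$. With $Y,\le_Y,E_Y,\alpha_Y$ as in the context: (i) $\mathbf Y=\langle Y,\le_Y\rangle$ is a poset; (ii) $E_Y$ is an equivalence relation on $Y$ with ${\le_Y}\subseteq E_Y$; (iii) $\alpha_Y$ is an order automorphism of $\mathbf Y$ with $\alpha_Y\subseteq E_Y$; (iv) if $0=\alpha_Y\circ(\le_Y)^{c\smile}=(\le_Y)^{c\smile}\circ\alpha_Y$, then $\langle\mathsf{Up}(\langle E_Y,\preceq_Y\rangle),\cap,\cup,\circ,\le_Y,0,{\sim},-\rangle$ is a distributive involutive FL-algebra.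
   Context: Let $X=\prod_{i\in I}X_i$ and for $x,y\in X$ put $(x,y)\in E_{\mathcal F}$ iff $\{i\in I\mid x(i)=y(i)\}\in\mathcal F$; this is an equivalence relation, and $Y=X/E_{\mathcal F}$. Define $[x]\le_Y[y]$ iff $\{i\mid x(i)\le_i y(i)\}\in\mathcal F$, and $([x],[y])\in E_Y$ iff $\{i\mid (x(i),y(i))\in E_i\}\in\mathcal F$. Define $\alpha_Y([x])=[\alpha_X(x)]$ where $(\alpha_X(x))(i)=\alpha_i(x(i))$. Order $E_Y$ by $([u],[v])\preceq_Y([x],[y])$ iff $[x]\le_Y[u]$ and $[v]\le_Y[y]$; $\mathsf{Up}$ denotes the set of upsets. For $R\subseteq E_Y$, $R^c=E_Y\setminus R$, $R^\smile$ is the converse, $\circ$ is relational composition. The operations ${\sim},-$ are the linear negations ${\sim}R=R\backslash0$, $-R=0/R$ with respect to the residuals of $\circ$ on upsets (these equal $R^{c\smile}\circ\alpha_Y$ and $\alpha_Y\circ R^{c\smile}$ respectively). A distributive involutive FL-algebra is a distributive residuated lattice with a distinguished element $0$ whose linear negations ${\sim}a=a\backslash0$, $-a=0/a$ satisfy $-{\sim}a=a={\sim}{-}a$. *)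

theory Defs
  imports "HOL-Algebra.Group"
begin

definition ultrafilter_on :: "'i set \<Rightarrow> 'i set set \<Rightarrow> bool" where
  "ultrafilter_on I F \<longleftrightarrow>
     F \<subseteq> Pow I \<and> I \<in> F \<and> {} \<notin> F \<and>
     (\<forall>A\<in>F. \<forall>B\<in>F. A \<inter> B \<in> F) \<and>
     (\<forall>A\<in>F. \<forall>B. A \<subseteq> B \<and> B \<subseteq> I \<longrightarrow> B \<in> F) \<and>
     (\<forall>A. A \<subseteq> I \<longrightarrow> A \<in> F \<or> I - A \<in> F)"

definition order_automorphism :: "'a set \<Rightarrow> 'a rel \<Rightarrow> ('a \<Rightarrow> 'a) \<Rightarrow> bool" where
  "order_automorphism A r f \<longleftrightarrow>
     bij_betw f A A \<and> (\<forall>x\<in>A. \<forall>y\<in>A. (x, y) \<in> r \<longleftrightarrow> (f x, f y) \<in> r)"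

definition graph_on :: "'a set \<Rightarrow> ('a \<Rightarrow> 'b) \<Rightarrow> ('a \<times> 'b) set" where
  "graph_on A f = {(x, f x) | x. x \<in> A}"

text \<open>The factors \<open>X i\<close> are subsets of one ambient type; this is no restriction, since the sets
  of a family can always be embedded into a common disjoint union. Points of the product are the
  extensional functions in \<open>PiE I X\<close>, so that two points are equal iff they agree on \<open>I\<close>.\<close>

definition ultra_eq :: "'i set \<Rightarrow> 'i set set \<Rightarrow> ('i \<Rightarrow> 'a set) \<Rightarrow> ('i \<Rightarrow> 'a) rel" where
  "ultra_eq I F X = {(x, y). x \<in> PiE I X \<and> y \<in> PiE I X \<and> {i\<in>I. x i = y i} \<in> F}"

definition ultra_class :: "'i set \<Rightarrow> 'i set set \<Rightarrow> ('i \<Rightarrow> 'a set) \<Rightarrow> ('i \<Rightarrow> 'a) \<Rightarrow> ('i \<Rightarrow> 'a) set" where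
  "ultra_class I F X x = ultra_eq I F X `` {x}"

definition ultraproduct :: "'i set \<Rightarrow> 'i set set \<Rightarrow> ('i \<Rightarrow> 'a set) \<Rightarrow> ('i \<Rightarrow> 'a) set set" where
  "ultraproduct I F X = PiE I X // ultra_eq I F X"

definition ultra_rel ::
    "'i set \<Rightarrow> 'i set set \<Rightarrow> ('i \<Rightarrow> 'a set) \<Rightarrow> ('i \<Rightarrow> 'a rel) \<Rightarrow> ('i \<Rightarrow> 'a) set rel" where
  "ultra_rel I F X r =
     {(ultra_class I F X x, ultra_class I F X y) | x y.
        x \<in> PiE I X \<and> y \<in> PiE I X \<and> {i\<in>I. (x i, y i) \<in> r i} \<in> F}"

definition prod_map :: "'i set \<Rightarrow> ('i \<Rightarrow> 'a \<Rightarrow> 'a) \<Rightarrow> ('i \<Rightarrow> 'a) \<Rightarrow> ('i \<Rightarrow> 'a)" where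
  "prod_map I \<alpha> x = (\<lambda>i\<in>I. \<alpha> i (x i))"

text \<open>The map \<open>[x] \<mapsto> [prod_map I \<alpha> x]\<close>, written as a union over representatives; all members of
  the union coincide (lemma \<open>ultra_map_class\<close> below).\<close>

definition ultra_map ::
    "'i set \<Rightarrow> 'i set set \<Rightarrow> ('i \<Rightarrow> 'a set) \<Rightarrow> ('i \<Rightarrow> 'a \<Rightarrow> 'a) \<Rightarrow> ('i \<Rightarrow> 'a) set \<Rightarrow> ('i \<Rightarrow> 'a) set" where
  "ultra_map I F X \<alpha> C = (\<Union>x\<in>C. ultra_class I F X (prod_map I \<alpha> x))"

lemma ultrafilter_on_Int: "ultrafilter_on I F \<Longrightarrow> A \<in> F \<Longrightarrow> B \<in> F \<Longrightarrow> A \<inter> B \<in> F"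
  by (simp add: ultrafilter_on_def)

lemma ultrafilter_on_mono:
  "ultrafilter_on I F \<Longrightarrow> A \<in> F \<Longrightarrow> A \<subseteq> B \<Longrightarrow> B \<subseteq> I \<Longrightarrow> B \<in> F"
  by (simp add: ultrafilter_on_def)

lemma equiv_ultra_eq:
  assumes "ultrafilter_on I F"
  shows "equiv (PiE I X) (ultra_eq I F X)"
proof (rule equivI)
  show "ultra_eq I F X \<subseteq> PiE I X \<times> PiE I X"
    by (auto simp: ultra_eq_def)
  show "refl_on (PiE I X) (ultra_eq I F X)"
    using assms by (auto simp: ultra_eq_def refl_on_def ultrafilter_on_def)
  show "sym (ultra_eq I F X)"
    by (rule symI) (auto simp: ultra_eq_def eq_commute)
  show "trans (ultra_eq I F X)"
  proof (rule transI)
    fix x y z assume xy: "(x, y) \<in> ultra_eq I F X" and yz: "(y, z) \<in> ultra_eq I F X"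
    have "{i\<in>I. x i = y i} \<inter> {i\<in>I. y i = z i} \<in> F"
      using xy yz by (intro ultrafilter_on_Int[OF assms]) (auto simp: ultra_eq_def)
    moreover have "{i\<in>I. x i = y i} \<inter> {i\<in>I. y i = z i} \<subseteq> {i\<in>I. x i = z i}"
      by auto
    ultimately have "{i\<in>I. x i = z i} \<in> F"
      by (rule ultrafilter_on_mono[OF assms]) auto
    with xy yz show "(x, z) \<in> ultra_eq I F X"
      by (auto simp: ultra_eq_def)
  qed
qed

lemma ultra_class_eq_iff:
  assumes "ultrafilter_on I F" "x \<in> PiE I X" "y \<in> PiE I X"
  shows "ultra_class I F X x = ultra_class I F X y \<longleftrightarrow> {i\<in>I. x i = y i} \<in> F"
  using eq_equiv_class_iff[OF equiv_ultra_eq[OF assms(1)] assms(2,3)] assms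
  by (simp add: ultra_class_def ultra_eq_def)

lemma ultra_rel_class_iff:
  assumes U: "ultrafilter_on I F" and x: "x \<in> PiE I X" and y: "y \<in> PiE I X"
  shows "(ultra_class I F X x, ultra_class I F X y) \<in> ultra_rel I F X r \<longleftrightarrow>
         {i\<in>I. (x i, y i) \<in> r i} \<in> F"
proof
  assume "(ultra_class I F X x, ultra_class I F X y) \<in> ultra_rel I F X r"
  then obtain x' y' where x': "x' \<in> PiE I X" "ultra_class I F X x = ultra_class I F X x'"
    and y': "y' \<in> PiE I X" "ultra_class I F X y = ultra_class I F X y'"
    and r: "{i\<in>I. (x' i, y' i) \<in> r i} \<in> F"
    unfolding ultra_rel_def by blast
  have "{i\<in>I. x i = x' i} \<in> F" "{i\<in>I. y i = y' i} \<in> F"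
    using ultra_class_eq_iff[OF U] x x' y y' by blast+
  then have "{i\<in>I. x i = x' i} \<inter> ({i\<in>I. y i = y' i} \<inter> {i\<in>I. (x' i, y' i) \<in> r i}) \<in> F"
    using r by (intro ultrafilter_on_Int[OF U])
  moreover have "{i\<in>I. x i = x' i} \<inter> ({i\<in>I. y i = y' i} \<inter> {i\<in>I. (x' i, y' i) \<in> r i})
      \<subseteq> {i\<in>I. (x i, y i) \<in> r i}"
    by auto
  ultimately show "{i\<in>I. (x i, y i) \<in> r i} \<in> F"
    by (rule ultrafilter_on_mono[OF U]) auto
next
  assume "{i\<in>I. (x i, y i) \<in> r i} \<in> F"
  with x y show "(ultra_class I F X x, ultra_class I F X y) \<in> ultra_rel I F X r"
    unfolding ultra_rel_def by blast
qed

lemma ultra_map_class: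
  assumes U: "ultrafilter_on I F" and \<alpha>: "\<And>i. i \<in> I \<Longrightarrow> \<alpha> i ` X i \<subseteq> X i" and x: "x \<in> PiE I X"
  shows "ultra_map I F X \<alpha> (ultra_class I F X x) = ultra_class I F X (prod_map I \<alpha> x)"
proof -
  have P: "prod_map I \<alpha> y \<in> PiE I X" if "y \<in> PiE I X" for y
    using that \<alpha> by (fastforce simp: prod_map_def PiE_iff)
  have "ultra_class I F X (prod_map I \<alpha> y) = ultra_class I F X (prod_map I \<alpha> x)"
    if "y \<in> ultra_class I F X x" for y
  proof -
    from that have y: "y \<in> PiE I X" and xy: "{i\<in>I. x i = y i} \<in> F"
      by (auto simp: ultra_class_def ultra_eq_def)
    have "{i\<in>I. prod_map I \<alpha> y i = prod_map I \<alpha> x i} \<in> F"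
      by (rule ultrafilter_on_mono[OF U xy]) (auto simp: prod_map_def)
    then show ?thesis
      using ultra_class_eq_iff[OF U P[OF y] P[OF x]] by simp
  qed
  moreover have "x \<in> ultra_class I F X x"
    using equiv_class_self[OF equiv_ultra_eq[OF U] x] by (simp add: ultra_class_def)
  ultimately show ?thesis
    unfolding ultra_map_def by blast
qed

text \<open>The signature is that of \<open>\<langle>A, \<and>, \<or>, \<cdot>, 1, 0, \<sim>, -\<rangle>\<close>; the residuals are not operations
  of the structure, since they are determined by the lattice order and the multiplication.\<close>

record 'a infl_algebra = "'a monoid" +
  lmeet :: "['a, 'a] \<Rightarrow> 'a" (infixl \<open>\<curlywedge>\<index>\<close> 70)
  ljoin :: "['a, 'a] \<Rightarrow> 'a" (infixl \<open>\<curlyvee>\<index>\<close> 65)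
  fzero :: 'a (\<open>\<zero>\<index>\<close>)
  tilde_neg :: "'a \<Rightarrow> 'a"
  minus_neg :: "'a \<Rightarrow> 'a"

definition lat_le :: "('a, 'b) infl_algebra_scheme \<Rightarrow> 'a \<Rightarrow> 'a \<Rightarrow> bool" where
  "lat_le A a b \<longleftrightarrow> a \<curlywedge>\<^bsub>A\<^esub> b = a"

text \<open>\<open>is_ldiv A a b c\<close> says that \<open>c\<close> is \<open>a \ b\<close>, and \<open>is_rdiv A b a c\<close> that \<open>c\<close> is \<open>b / a\<close>.\<close>

definition is_ldiv :: "('a, 'b) infl_algebra_scheme \<Rightarrow> 'a \<Rightarrow> 'a \<Rightarrow> 'a \<Rightarrow> bool" where
  "is_ldiv A a b c \<longleftrightarrow>
     c \<in> carrier A \<and> (\<forall>x\<in>carrier A. lat_le A (a \<otimes>\<^bsub>A\<^esub> x) b \<longleftrightarrow> lat_le A x c)"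

definition is_rdiv :: "('a, 'b) infl_algebra_scheme \<Rightarrow> 'a \<Rightarrow> 'a \<Rightarrow> 'a \<Rightarrow> bool" where
  "is_rdiv A b a c \<longleftrightarrow>
     c \<in> carrier A \<and> (\<forall>x\<in>carrier A. lat_le A (x \<otimes>\<^bsub>A\<^esub> a) b \<longleftrightarrow> lat_le A x c)"

locale distributive_residuated_lattice = monoid A for A (structure) +
  assumes meet_closed: "\<lbrakk>a \<in> carrier A; b \<in> carrier A\<rbrakk> \<Longrightarrow> a \<curlywedge> b \<in> carrier A"
    and join_closed: "\<lbrakk>a \<in> carrier A; b \<in> carrier A\<rbrakk> \<Longrightarrow> a \<curlyvee> b \<in> carrier A"
    and meet_assoc: "\<lbrakk>a \<in> carrier A; b \<in> carrier A; c \<in> carrier A\<rbrakk>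
          \<Longrightarrow> (a \<curlywedge> b) \<curlywedge> c = a \<curlywedge> (b \<curlywedge> c)"
    and join_assoc: "\<lbrakk>a \<in> carrier A; b \<in> carrier A; c \<in> carrier A\<rbrakk>
          \<Longrightarrow> (a \<curlyvee> b) \<curlyvee> c = a \<curlyvee> (b \<curlyvee> c)"
    and meet_commute: "\<lbrakk>a \<in> carrier A; b \<in> carrier A\<rbrakk> \<Longrightarrow> a \<curlywedge> b = b \<curlywedge> a"
    and join_commute: "\<lbrakk>a \<in> carrier A; b \<in> carrier A\<rbrakk> \<Longrightarrow> a \<curlyvee> b = b \<curlyvee> a"
    and meet_absorb: "\<lbrakk>a \<in> carrier A; b \<in> carrier A\<rbrakk> \<Longrightarrow> a \<curlywedge> (a \<curlyvee> b) = a"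
    and join_absorb: "\<lbrakk>a \<in> carrier A; b \<in> carrier A\<rbrakk> \<Longrightarrow> a \<curlyvee> (a \<curlywedge> b) = a"
    and meet_join_distrib: "\<lbrakk>a \<in> carrier A; b \<in> carrier A; c \<in> carrier A\<rbrakk>
          \<Longrightarrow> a \<curlywedge> (b \<curlyvee> c) = (a \<curlywedge> b) \<curlyvee> (a \<curlywedge> c)"
    and ldiv_exists: "\<lbrakk>a \<in> carrier A; b \<in> carrier A\<rbrakk> \<Longrightarrow> \<exists>c. is_ldiv A a b c"
    and rdiv_exists: "\<lbrakk>a \<in> carrier A; b \<in> carrier A\<rbrakk> \<Longrightarrow> \<exists>c. is_rdiv A b a c"

locale distributive_involutive_FL_algebra = distributive_residuated_lattice +
  assumes zero_closed: "\<zero> \<in> carrier A"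
    and tilde_neg_ldiv: "a \<in> carrier A \<Longrightarrow> is_ldiv A a \<zero> (tilde_neg A a)"
    and minus_neg_rdiv: "a \<in> carrier A \<Longrightarrow> is_rdiv A \<zero> a (minus_neg A a)"
    and minus_tilde: "a \<in> carrier A \<Longrightarrow> minus_neg A (tilde_neg A a) = a"
    and tilde_minus: "a \<in> carrier A \<Longrightarrow> tilde_neg A (minus_neg A a) = a"

definition pair_order :: "'b rel \<Rightarrow> 'b rel \<Rightarrow> ('b \<times> 'b) rel" where
  "pair_order E r =
     {((u, v), (x, y)) | u v x y. (u, v) \<in> E \<and> (x, y) \<in> E \<and> (x, u) \<in> r \<and> (v, y) \<in> r}"

definition upsets :: "'b set \<Rightarrow> 'b rel \<Rightarrow> 'b set set" where
  "upsets P r = {U. U \<subseteq> P \<and> (\<forall>p\<in>U. \<forall>q\<in>P. (p, q) \<in> r \<longrightarrow> q \<in> U)}"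

text \<open>The residuals of composition on a family \<open>\<U>\<close> of relations: the largest \<open>T\<close> in \<open>\<U>\<close> with
  \<open>R O T \<subseteq> S\<close>, respectively \<open>T O R \<subseteq> S\<close>, obtained as the union of all of them (the upsets are
  closed under unions). Composition is read from left to right, as in the library's \<open>O\<close>.\<close>

definition rel_ldiv :: "'b rel set \<Rightarrow> 'b rel \<Rightarrow> 'b rel \<Rightarrow> 'b rel" where
  "rel_ldiv \<U> R S = \<Union>{T\<in>\<U>. R O T \<subseteq> S}"

definition rel_rdiv :: "'b rel set \<Rightarrow> 'b rel \<Rightarrow> 'b rel \<Rightarrow> 'b rel" where
  "rel_rdiv \<U> S R = \<Union>{T\<in>\<U>. T O R \<subseteq> S}"

definition upset_algebra :: "'b rel \<Rightarrow> 'b rel \<Rightarrow> 'b rel \<Rightarrow> 'b rel infl_algebra" where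
  "upset_algebra E r Z =
     (let \<U> = upsets E (pair_order E r) in
      \<lparr>carrier = \<U>, monoid.mult = (O), one = r,
       lmeet = (\<inter>), ljoin = (\<union>), fzero = Z,
       tilde_neg = (\<lambda>R. rel_ldiv \<U> R Z), minus_neg = (\<lambda>R. rel_rdiv \<U> Z R)\<rparr>)"

end

theory Submission
  imports Defs
begin

text \<open>Parts (i)-(iii) are instances of the transfer principle for ultraproducts; since the relations
  involved are defined by universal Horn conditions, only closure of the filter under finite
  intersections and supersets is needed, except that surjectivity of the induced map uses a
  pointwise preimage. Part (iv) holds for any poset with a compatible equivalence relation \<open>E\<close> and
  automorphism \<open>a\<close>: in \<open>R \ 0\<close> a pair \<open>(x, a w)\<close> must satisfy \<open>(w, x) \<notin> R\<close>, as otherwise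
  \<open>(w, a w) \<in> 0\<close>, and the pairs \<open>(x, a w) \<in> E\<close> with \<open>(w, x) \<notin> R\<close> already form an upset. The dual
  description holds for \<open>0 / R\<close>, and the two complementations cancel.\<close>

section \<open>The upset algebra over an arbitrary poset with equivalence relation and
  automorphism\<close>

locale involutive_frame =
  fixes Y :: "'b set" and r E :: "'b rel" and a :: "'b \<Rightarrow> 'b"
  assumes partial_order: "partial_order_on Y r"
    and equiv: "equiv Y E"
    and r_sub_E: "r \<subseteq> E"
    and automorphism: "order_automorphism Y r a"
    and graph_sub_E: "graph_on Y a \<subseteq> E"
begin

text \<open>The element 0 in its first form, with the complement of \<open>r\<close> taken inside
  \<open>E\<close>; that the second form agrees is \<open>Z_commute\<close>.\<close>

definition Z :: "'b rel" where
  "Z = graph_on Y a O (E - r)\<inverse>"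

abbreviation Up :: "'b rel set" where
  "Up \<equiv> upsets E (pair_order E r)"

lemma r_refl: "x \<in> Y \<Longrightarrow> (x, x) \<in> r"
  using partial_order by (auto simp: partial_order_on_def preorder_on_def refl_on_def)

lemma r_trans: "(x, y) \<in> r \<Longrightarrow> (y, z) \<in> r \<Longrightarrow> (x, z) \<in> r"
  using partial_order by (auto simp: partial_order_on_def preorder_on_def dest: transD)

lemma E_sym: "(x, y) \<in> E \<Longrightarrow> (y, x) \<in> E"
  using equiv by (auto simp: equiv_def dest: symD)

lemma E_trans: "(x, y) \<in> E \<Longrightarrow> (y, z) \<in> E \<Longrightarrow> (x, z) \<in> E"
  using equiv by (auto simp: equiv_def dest: transD)

lemma E_in: "(x, y) \<in> E \<Longrightarrow> x \<in> Y" "(x, y) \<in> E \<Longrightarrow> y \<in> Y"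
  using equiv by (auto simp: equiv_def)

lemma r_in_E: "(x, y) \<in> r \<Longrightarrow> (x, y) \<in> E"
  using r_sub_E by blast

lemma a_in: "x \<in> Y \<Longrightarrow> a x \<in> Y"
  using automorphism by (auto simp: order_automorphism_def bij_betw_def)

lemma a_surj: "y \<in> Y \<Longrightarrow> \<exists>x\<in>Y. y = a x"
  using automorphism by (auto simp: order_automorphism_def bij_betw_def)

lemma a_eq_iff: "x \<in> Y \<Longrightarrow> y \<in> Y \<Longrightarrow> a x = a y \<longleftrightarrow> x = y"
  using automorphism by (auto simp: order_automorphism_def bij_betw_def inj_on_def)

lemma a_r_iff: "x \<in> Y \<Longrightarrow> y \<in> Y \<Longrightarrow> (a x, a y) \<in> r \<longleftrightarrow> (x, y) \<in> r"
  using automorphism by (auto simp: order_automorphism_def)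

lemma E_a: "x \<in> Y \<Longrightarrow> (x, a x) \<in> E"
  using graph_sub_E by (auto simp: graph_on_def)

lemma E_a_iff: "y \<in> Y \<Longrightarrow> (x, a y) \<in> E \<longleftrightarrow> (x, y) \<in> E"
  using E_a E_sym E_trans by meson

lemma Z_iff: "(x, y) \<in> Z \<longleftrightarrow> (x, y) \<in> E \<and> (y, a x) \<notin> r"
  unfolding Z_def graph_on_def using E_in E_sym E_a_iff by auto

text \<open>With \<open>y = a w\<close>, the left side asks that \<open>(a w, a x)\<close> be
  outside \<open>r\<close>, the right side that \<open>(w, x)\<close> be outside \<open>r\<close>;
  \<open>a\<close> preserves and reflects the order. Injectivity makes \<open>w\<close>
  unique.\<close>

lemma Z_commute: "graph_on Y a O (E - r)\<inverse> = (E - r)\<inverse> O graph_on Y a"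
proof (rule Set.set_eqI, unfold split_paired_all)
  fix x y
  have "(x, y) \<in> Z \<longleftrightarrow> (x, y) \<in> (E - r)\<inverse> O graph_on Y a"
  proof (cases "y \<in> Y")
    case True
    then obtain w where w: "w \<in> Y" "y = a w"
      using a_surj by blast
    have "(x, y) \<in> (E - r)\<inverse> O graph_on Y a \<longleftrightarrow> (w, x) \<in> E \<and> (w, x) \<notin> r"
      using w a_eq_iff by (auto simp: graph_on_def)
    moreover have "(x, y) \<in> Z \<longleftrightarrow> (x, w) \<in> E \<and> (w, x) \<notin> r"
      using w E_in a_r_iff E_a_iff by (auto simp: Z_iff)
    ultimately show ?thesis
      using E_sym by blast
  next
    case False
    then show ?thesis
      using E_in a_in by (auto simp: Z_iff graph_on_def)
  qed
  then show "(x, y) \<in> graph_on Y a O (E - r)\<inverse> \<longleftrightarrow> (x, y) \<in> (E - r)\<inverse> O graph_on Y a"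
    by (simp add: Z_def)
qed

text \<open>Since \<open>r\<close> lies in \<open>E\<close> and \<open>E\<close> is transitive, the
  \<open>E\<close>-conditions in \<open>pair_order\<close> hold automatically. What remains is that
  \<open>U\<close> absorbs \<open>r\<close> on both sides.\<close>

lemma mem_Up_iff:
  "U \<in> Up \<longleftrightarrow> U \<subseteq> E \<and> (\<forall>x u v y. (x, u) \<in> r \<longrightarrow> (u, v) \<in> U \<longrightarrow> (v, y) \<in> r \<longrightarrow> (x, y) \<in> U)"
  (is "_ \<longleftrightarrow> ?R")
proof
  assume U: "U \<in> Up"
  then have "U \<subseteq> E"
    by (simp add: upsets_def)
  moreover have "(x, y) \<in> U" if "(x, u) \<in> r" "(u, v) \<in> U" "(v, y) \<in> r" for x u v y
  proof -
    have "(u, v) \<in> E" "(x, y) \<in> E"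
      using that \<open>U \<subseteq> E\<close> r_in_E E_trans by blast+
    then have "((u, v), (x, y)) \<in> pair_order E r"
      using that by (auto simp: pair_order_def)
    then show ?thesis
      using U \<open>(x, y) \<in> E\<close> that(2) by (auto simp: upsets_def)
  qed
  ultimately show ?R
    by blast
next
  assume ?R
  then show "U \<in> Up"
    unfolding upsets_def pair_order_def by blast
qed

lemma UpI:
  assumes "U \<subseteq> E" "\<And>x u v y. (x, u) \<in> r \<Longrightarrow> (u, v) \<in> U \<Longrightarrow> (v, y) \<in> r \<Longrightarrow> (x, y) \<in> U"
  shows "U \<in> Up"
  using assms mem_Up_iff by blast

lemma Up_sub: "U \<in> Up \<Longrightarrow> U \<subseteq> E"
  by (simp add: mem_Up_iff)

lemma UpD: "U \<in> Up \<Longrightarrow> (x, u) \<in> r \<Longrightarrow> (u, v) \<in> U \<Longrightarrow> (v, y) \<in> r \<Longrightarrow> (x, y) \<in> U"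
  unfolding mem_Up_iff by blast

lemma UpD1: "U \<in> Up \<Longrightarrow> (x, u) \<in> r \<Longrightarrow> (u, v) \<in> U \<Longrightarrow> (x, v) \<in> U"
  using UpD Up_sub E_in r_refl by blast

lemma UpD2: "U \<in> Up \<Longrightarrow> (u, v) \<in> U \<Longrightarrow> (v, y) \<in> r \<Longrightarrow> (u, y) \<in> U"
  using UpD Up_sub E_in r_refl by blast

lemma Up_relcomp:
  assumes "U \<in> Up" "V \<in> Up"
  shows "U O V \<in> Up"
proof (rule UpI)
  show "U O V \<subseteq> E"
    using Up_sub[OF assms(1)] Up_sub[OF assms(2)] E_trans by blast
  show "(x, y) \<in> U O V" if "(x, u) \<in> r" "(u, v) \<in> U O V" "(v, y) \<in> r" for x u v y
    using that UpD1[OF assms(1)] UpD2[OF assms(2)] by blast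
qed

lemma Up_r: "r \<in> Up"
  using r_sub_E r_trans by (blast intro: UpI)

lemma Up_Int: "U \<in> Up \<Longrightarrow> V \<in> Up \<Longrightarrow> U \<inter> V \<in> Up"
  unfolding mem_Up_iff by blast

lemma Up_Union: "\<U> \<subseteq> Up \<Longrightarrow> \<Union>\<U> \<in> Up"
  unfolding mem_Up_iff subset_iff by blast

lemma Up_Un: "U \<in> Up \<Longrightarrow> V \<in> Up \<Longrightarrow> U \<union> V \<in> Up"
  using Up_Union[of "{U, V}"] by simp

text \<open>If \<open>(y, a x)\<close> were in \<open>r\<close>, the chain \<open>v\<close>,
  \<open>y\<close>, \<open>a x\<close>, \<open>a u\<close> would put \<open>(v, a u)\<close> in
  \<open>r\<close>, contradicting \<open>(u, v) \<in> Z\<close>.\<close>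

lemma Up_Z: "Z \<in> Up"
proof (rule UpI)
  show "Z \<subseteq> E"
    by (auto simp: Z_iff)
  show "(x, y) \<in> Z" if xu: "(x, u) \<in> r" and uv: "(u, v) \<in> Z" and vy: "(v, y) \<in> r" for x u v y
  proof -
    have E: "(x, u) \<in> E" "(u, v) \<in> E" "(v, y) \<in> E"
      using xu uv vy r_in_E by (auto simp: Z_iff)
    have "(a x, a u) \<in> r"
      using xu E E_in a_r_iff by blast
    then have "(y, a x) \<notin> r"
      using uv vy r_trans unfolding Z_iff by blast
    then show ?thesis
      using E E_trans unfolding Z_iff by blast
  qed
qed

text \<open>Absorption gives one inclusion, reflexivity of \<open>r\<close> the other; so
  \<open>r\<close> is the unit.\<close>

lemma r_relcomp: "U \<in> Up \<Longrightarrow> r O U = U"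
  by (rule Set.set_eqI, unfold split_paired_all) (use UpD1 Up_sub E_in r_refl in blast)

lemma relcomp_r: "U \<in> Up \<Longrightarrow> U O r = U"
  by (rule Set.set_eqI, unfold split_paired_all) (use UpD2 Up_sub E_in r_refl in blast)

section \<open>Residuals and linear negations on upsets\<close>

lemma ldiv_Up: "rel_ldiv Up R S \<in> Up"
  unfolding rel_ldiv_def by (rule Up_Union) blast

lemma rdiv_Up: "rel_rdiv Up S R \<in> Up"
  unfolding rel_rdiv_def by (rule Up_Union) blast

text \<open>Composition distributes over unions, so the union of all solutions is itself a
  solution.\<close>

lemma ldiv_adjoint: "T \<in> Up \<Longrightarrow> R O T \<subseteq> S \<longleftrightarrow> T \<subseteq> rel_ldiv Up R S"
  unfolding rel_ldiv_def by blast

lemma rdiv_adjoint: "T \<in> Up \<Longrightarrow> T O R \<subseteq> S \<longleftrightarrow> T \<subseteq> rel_rdiv Up S R"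
  unfolding rel_rdiv_def by blast

lemma ldiv_Z_iff:
  assumes R: "R \<in> Up" and w: "w \<in> Y"
  shows "(x, a w) \<in> rel_ldiv Up R Z \<longleftrightarrow> (x, w) \<in> E \<and> (w, x) \<notin> R"
proof
  assume "(x, a w) \<in> rel_ldiv Up R Z"
  then obtain T where T: "T \<in> Up" "R O T \<subseteq> Z" "(x, a w) \<in> T"
    unfolding rel_ldiv_def by blast
  \<comment> \<open>If \<open>(w, x)\<close> were in \<open>R\<close>, then \<open>(w, a w)\<close>
    would lie in \<open>R O T\<close>, hence in \<open>Z\<close>, which reflexivity at
    \<open>a w\<close> forbids.\<close>
  have "(a w, a w) \<in> r"
    using w a_in r_refl by blast
  then have "(w, x) \<notin> R"
    using T Z_iff by blast
  moreover have "(x, w) \<in> E"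
    using T Up_sub w E_a_iff by blast
  ultimately show "(x, w) \<in> E \<and> (w, x) \<notin> R"
    by blast
next
  \<comment> \<open>The candidate for the largest solution: once \<open>N\<close> is an upset with
    \<open>R O N \<subseteq> Z\<close>, it is one of the relations in the union.\<close>
  define N where "N = {(x, a w) | x w. (x, w) \<in> E \<and> (w, x) \<notin> R}"
  have N_iff: "(x, a w) \<in> N \<longleftrightarrow> (x, w) \<in> E \<and> (w, x) \<notin> R" if "w \<in> Y" for x w
    unfolding N_def using that a_eq_iff E_in(2) by auto
  have "N \<in> Up"
  proof (rule UpI)
    show sub: "N \<subseteq> E"
      unfolding N_def using E_in E_a_iff by auto
    show "(x, y) \<in> N" if xu: "(x, u) \<in> r" and uv: "(u, v) \<in> N" and vy: "(v, y) \<in> r" for x u v y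
    proof -
      obtain v' y' where v': "v' \<in> Y" "v = a v'" and y': "y' \<in> Y" "y = a y'"
        using vy r_in_E E_in a_surj by meson
      have "(v', y') \<in> r"
        using vy v' y' a_r_iff by blast
      moreover have "(u, v') \<in> E" "(v', u) \<notin> R"
        using uv v' N_iff by blast+
      \<comment> \<open>Otherwise absorbing \<open>(v', y')\<close> on the left and
        \<open>(x, u)\<close> on the right would give \<open>(v', u) \<in> R\<close>.\<close>
      ultimately have "(y', x) \<notin> R"
        using UpD[OF R] xu by blast
      moreover have "(x, y') \<in> E"
        using xu \<open>(u, v') \<in> E\<close> \<open>(v', y') \<in> r\<close> r_in_E E_trans by blast
      ultimately show ?thesis
        using N_iff y' by blast
    qed
  qed
  moreover have "R O N \<subseteq> Z"
  proof clarify
    fix u x y assume ux: "(u, x) \<in> R" and xy: "(x, y) \<in> N"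
    obtain w where w: "y = a w" "(x, w) \<in> E" "(w, x) \<notin> R"
      using xy unfolding N_def by blast
    have ux': "(u, x) \<in> E"
      using ux R Up_sub by blast
    have Y: "u \<in> Y" "w \<in> Y"
      using ux' w E_in by blast+
    \<comment> \<open>Otherwise \<open>(u, x) \<in> R\<close> would yield
      \<open>(w, x) \<in> R\<close>.\<close>
    have "(w, u) \<notin> r"
      using UpD1[OF R] ux w by blast
    then show "(u, y) \<in> Z"
      using Y w ux' E_trans E_a_iff a_r_iff unfolding Z_iff by blast
  qed
  moreover assume "(x, w) \<in> E \<and> (w, x) \<notin> R"
  ultimately show "(x, a w) \<in> rel_ldiv Up R Z"
    using N_iff[OF w] unfolding rel_ldiv_def by blast
qed

text \<open>The dual description: here \<open>0 / R\<close> is \<open>a\<close> followed by the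
  converse complement of \<open>R\<close>, so \<open>a\<close> acts on the first coordinate and
  \<open>y\<close> stays arbitrary.\<close>

lemma rdiv_Z_iff:
  assumes R: "R \<in> Up"
  shows "(x, y) \<in> rel_rdiv Up Z R \<longleftrightarrow> (x, y) \<in> E \<and> (y, a x) \<notin> R"
proof
  assume "(x, y) \<in> rel_rdiv Up Z R"
  then obtain T where T: "T \<in> Up" "T O R \<subseteq> Z" "(x, y) \<in> T"
    unfolding rel_rdiv_def by blast
  then have xy: "(x, y) \<in> E"
    using Up_sub by blast
  \<comment> \<open>This pair is the obstruction: \<open>(y, a x) \<in> R\<close> would place
    \<open>(x, a x)\<close> in \<open>Z\<close>.\<close>
  then have "(a x, a x) \<in> r"
    using E_in a_in r_refl by blast
  then have "(y, a x) \<notin> R"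
    using T Z_iff by blast
  with xy show "(x, y) \<in> E \<and> (y, a x) \<notin> R"
    by blast
next
  define N where "N = {(x, y). (x, y) \<in> E \<and> (y, a x) \<notin> R}"
  have "N \<in> Up"
  proof (rule UpI)
    show "N \<subseteq> E"
      unfolding N_def by blast
    show "(x, y) \<in> N" if xu: "(x, u) \<in> r" and uv: "(u, v) \<in> N" and vy: "(v, y) \<in> r" for x u v y
    proof -
      have "(a x, a u) \<in> r"
        using xu a_r_iff r_in_E E_in by blast
      then have "(y, a x) \<notin> R"
        using uv vy UpD[OF R] unfolding N_def by blast
      then show ?thesis
        using xu uv vy r_in_E E_trans unfolding N_def by blast
    qed
  qed
  moreover have "N O R \<subseteq> Z"
  proof clarify
    fix u x y assume ux: "(u, x) \<in> N" and xy: "(x, y) \<in> R"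
    \<comment> \<open>Otherwise \<open>(x, y) \<in> R\<close> extends to
      \<open>(x, a u) \<in> R\<close>, against \<open>(u, x) \<in> N\<close>.\<close>
    have "(y, a u) \<notin> r"
      using UpD2[OF R] ux xy unfolding N_def by blast
    moreover have "(u, y) \<in> E"
      using ux xy Up_sub[OF R] E_trans unfolding N_def by blast
    ultimately show "(u, y) \<in> Z"
      unfolding Z_iff by blast
  qed
  moreover assume "(x, y) \<in> E \<and> (y, a x) \<notin> R"
  ultimately show "(x, y) \<in> rel_rdiv Up Z R"
    unfolding rel_rdiv_def N_def by blast
qed

text \<open>The outer negation tests \<open>(y, a x)\<close>, which is exactly the shape
  \<open>ldiv_Z_iff\<close> describes with \<open>w = x\<close>; the two complements relative to
  \<open>E\<close> then cancel.\<close>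

lemma rdiv_ldiv_Z:
  assumes R: "R \<in> Up"
  shows "rel_rdiv Up Z (rel_ldiv Up R Z) = R"
proof (rule Set.set_eqI, unfold split_paired_all)
  fix x y
  show "(x, y) \<in> rel_rdiv Up Z (rel_ldiv Up R Z) \<longleftrightarrow> (x, y) \<in> R"
    using rdiv_Z_iff[OF ldiv_Up] ldiv_Z_iff[OF R] E_in E_sym Up_sub[OF R] by blast
qed

lemma ldiv_rdiv_Z:
  assumes R: "R \<in> Up"
  shows "rel_ldiv Up (rel_rdiv Up Z R) Z = R"
proof (rule Set.set_eqI, unfold split_paired_all)
  fix x y
  show "(x, y) \<in> rel_ldiv Up (rel_rdiv Up Z R) Z \<longleftrightarrow> (x, y) \<in> R"
  proof (cases "y \<in> Y")
    case True
    then obtain w where w: "w \<in> Y" "y = a w"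
      using a_surj by blast
    show ?thesis
      using ldiv_Z_iff[OF rdiv_Up w(1)] rdiv_Z_iff[OF R] w E_a_iff E_sym Up_sub[OF R] by blast
  next
    case False
    then show ?thesis
      using Up_sub[OF ldiv_Up] Up_sub[OF R] E_in by blast
  qed
qed

text \<open>Meet and join are set operations, so the lattice and distributive laws are those of
  sets; closure, units, residuation and the two cancellations supply the rest.\<close>

theorem upset_algebra_involutive:
  "distributive_involutive_FL_algebra (upset_algebra E r Z)"
proof -
  let ?A = "upset_algebra E r Z"
  have sel [simp]: "carrier ?A = Up" "monoid.mult ?A = (O)" "one ?A = r" "lmeet ?A = (\<inter>)"
    "ljoin ?A = (\<union>)" "fzero ?A = Z" "tilde_neg ?A = (\<lambda>R. rel_ldiv Up R Z)"
    "minus_neg ?A = (\<lambda>R. rel_rdiv Up Z R)"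
    by (simp_all add: upset_algebra_def Let_def)
  have le [simp]: "lat_le ?A S T \<longleftrightarrow> S \<subseteq> T" for S T
    by (auto simp: lat_le_def)
  have ldiv: "is_ldiv ?A R S (rel_ldiv Up R S)" for R S
    by (simp add: is_ldiv_def ldiv_Up ldiv_adjoint)
  have rdiv: "is_rdiv ?A S R (rel_rdiv Up S R)" for R S
    by (simp add: is_rdiv_def rdiv_Up rdiv_adjoint)
  show ?thesis
    by unfold_locales
      (auto simp: Up_relcomp Up_r Up_Int Up_Un Up_Z r_relcomp relcomp_r ldiv rdiv
        rdiv_ldiv_Z ldiv_rdiv_Z O_assoc intro: ldiv rdiv)
qed

end

section \<open>Transfer of relations and maps to the ultraproduct\<close>

lemma ultraproduct_cases:
  assumes "C \<in> ultraproduct I F X"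
  obtains x where "x \<in> PiE I X" "C = ultra_class I F X x"
  using assms by (auto simp: ultraproduct_def ultra_class_def quotient_def)

lemma ultra_class_in: "x \<in> PiE I X \<Longrightarrow> ultra_class I F X x \<in> ultraproduct I F X"
  by (auto simp: ultraproduct_def ultra_class_def quotient_def)

lemma ultra_rel_subset: "ultra_rel I F X r \<subseteq> ultraproduct I F X \<times> ultraproduct I F X"
  by (auto simp: ultra_rel_def ultra_class_in)

locale ultrafilter =
  fixes I :: "'i set" and F :: "'i set set"
  assumes ultrafilter: "ultrafilter_on I F"
begin

text \<open>Closure under intersections and supersets in one rule, phrased with predicates so that a
  pointwise implication lifts directly.\<close>

lemma eventually_mono2:
  assumes "{i\<in>I. P i} \<in> F" "{i\<in>I. Q i} \<in> F" "\<And>i. i \<in> I \<Longrightarrow> P i \<Longrightarrow> Q i \<Longrightarrow> S i"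
  shows "{i\<in>I. S i} \<in> F"
  by (rule ultrafilter_on_mono[OF ultrafilter ultrafilter_on_Int[OF ultrafilter assms(1,2)]])
    (use assms(3) in auto)

lemma eventually_mono1:
  assumes "{i\<in>I. P i} \<in> F" "\<And>i. i \<in> I \<Longrightarrow> P i \<Longrightarrow> S i"
  shows "{i\<in>I. S i} \<in> F"
  using eventually_mono2[OF assms(1,1)] assms(2) by blast

lemma all_in: "(\<And>i. i \<in> I \<Longrightarrow> P i) \<Longrightarrow> {i\<in>I. P i} \<in> F"
  using ultrafilter by (simp add: ultrafilter_on_def cong: conj_cong)

text \<open>With \<open>rel_class_iff\<close>, these are the atomic cases of the theorem of Los, for
  arbitrary representatives.\<close>

lemmas class_eq_iff = ultra_class_eq_iff[OF ultrafilter]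
lemmas rel_class_iff = ultra_rel_class_iff[OF ultrafilter]

lemma refl_on_ultra_rel:
  assumes "\<And>i. i \<in> I \<Longrightarrow> refl_on (X i) (r i)"
  shows "refl_on (ultraproduct I F X) (ultra_rel I F X r)"
proof (rule refl_onI)
  fix C assume "C \<in> ultraproduct I F X"
  then obtain x where x: "x \<in> PiE I X" and C: "C = ultra_class I F X x"
    by (rule ultraproduct_cases)
  have "{i\<in>I. (x i, x i) \<in> r i} \<in> F"
    using assms x by (intro all_in) (auto simp: refl_on_def)
  then show "(C, C) \<in> ultra_rel I F X r"
    using rel_class_iff[OF x x] C by simp
qed

lemma sym_ultra_rel:
  assumes "\<And>i. i \<in> I \<Longrightarrow> sym (r i)"
  shows "sym (ultra_rel I F X r)"
proof (rule symI)
  fix C D assume "(C, D) \<in> ultra_rel I F X r"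
  then obtain x y where *: "x \<in> PiE I X" "y \<in> PiE I X" "{i\<in>I. (x i, y i) \<in> r i} \<in> F"
    and CD: "C = ultra_class I F X x" "D = ultra_class I F X y"
    unfolding ultra_rel_def by blast
  have "{i\<in>I. (y i, x i) \<in> r i} \<in> F"
    using eventually_mono1[OF *(3)] assms by (meson symD)
  then show "(D, C) \<in> ultra_rel I F X r"
    using rel_class_iff[OF *(2,1)] CD by simp
qed

text \<open>Only representatives are delivered. Membership in \<open>F\<close> is then read off by
  \<open>rel_class_iff\<close>, so a class occurring in several pairs keeps a single
  representative.\<close>

lemma ultra_relE:
  assumes "(C, D) \<in> ultra_rel I F X r"
  obtains x y where "x \<in> PiE I X" "y \<in> PiE I X" "C = ultra_class I F X x" "D = ultra_class I F X y"
  using assms unfolding ultra_rel_def by blast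

lemma trans_ultra_rel:
  assumes "\<And>i. i \<in> I \<Longrightarrow> trans (r i)"
  shows "trans (ultra_rel I F X r)"
proof (rule transI)
  fix B C D assume BC: "(B, C) \<in> ultra_rel I F X r" and CD: "(C, D) \<in> ultra_rel I F X r"
  obtain x y where xy: "x \<in> PiE I X" "y \<in> PiE I X" "B = ultra_class I F X x" "C = ultra_class I F X y"
    using BC by (rule ultra_relE)
  obtain z where z: "z \<in> PiE I X" "D = ultra_class I F X z"
    using CD by (rule ultra_relE)
  have "{i\<in>I. (x i, y i) \<in> r i} \<in> F" "{i\<in>I. (y i, z i) \<in> r i} \<in> F"
    using BC CD xy z rel_class_iff by blast+
  then have "{i\<in>I. (x i, z i) \<in> r i} \<in> F"
    by (rule eventually_mono2) (use assms in \<open>meson transD\<close>)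
  then show "(B, D) \<in> ultra_rel I F X r"
    using xy z rel_class_iff by blast
qed

lemma antisym_ultra_rel:
  assumes "\<And>i. i \<in> I \<Longrightarrow> antisym (r i)"
  shows "antisym (ultra_rel I F X r)"
proof (rule antisymI)
  fix C D assume CD: "(C, D) \<in> ultra_rel I F X r" and DC: "(D, C) \<in> ultra_rel I F X r"
  obtain x y where xy: "x \<in> PiE I X" "y \<in> PiE I X" "C = ultra_class I F X x" "D = ultra_class I F X y"
    using CD by (rule ultra_relE)
  have "{i\<in>I. (x i, y i) \<in> r i} \<in> F" "{i\<in>I. (y i, x i) \<in> r i} \<in> F"
    using CD DC xy rel_class_iff by blast+
  then have "{i\<in>I. x i = y i} \<in> F"
    by (rule eventually_mono2) (use assms in \<open>meson antisymD\<close>)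
  then show "C = D"
    using xy class_eq_iff by blast
qed

lemma ultra_rel_mono:
  assumes "\<And>i. i \<in> I \<Longrightarrow> r i \<subseteq> s i"
  shows "ultra_rel I F X r \<subseteq> ultra_rel I F X s"
proof clarify
  fix C D assume CD: "(C, D) \<in> ultra_rel I F X r"
  obtain x y where xy: "x \<in> PiE I X" "y \<in> PiE I X" "C = ultra_class I F X x" "D = ultra_class I F X y"
    using CD by (rule ultra_relE)
  then have "{i\<in>I. (x i, y i) \<in> r i} \<in> F"
    using CD rel_class_iff by blast
  then have "{i\<in>I. (x i, y i) \<in> s i} \<in> F"
    by (rule eventually_mono1) (use assms in blast)
  then show "(C, D) \<in> ultra_rel I F X s"
    using xy rel_class_iff by blast
qed

lemma partial_order_on_ultra_rel:
  assumes "\<And>i. i \<in> I \<Longrightarrow> partial_order_on (X i) (r i)"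
  shows "partial_order_on (ultraproduct I F X) (ultra_rel I F X r)"
  unfolding partial_order_on_def preorder_on_def
  by (intro conjI ultra_rel_subset refl_on_ultra_rel trans_ultra_rel antisym_ultra_rel)
    (use assms in \<open>auto simp: partial_order_on_def preorder_on_def\<close>)

lemma equiv_ultra_rel:
  assumes "\<And>i. i \<in> I \<Longrightarrow> equiv (X i) (r i)"
  shows "equiv (ultraproduct I F X) (ultra_rel I F X r)"
  unfolding equiv_def
  by (intro conjI ultra_rel_subset refl_on_ultra_rel trans_ultra_rel sym_ultra_rel)
    (use assms in \<open>auto simp: equiv_def\<close>)

lemma prod_map_in:
  assumes "\<And>i. i \<in> I \<Longrightarrow> f i ` X i \<subseteq> X i" "x \<in> PiE I X"
  shows "prod_map I f x \<in> PiE I X"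
  using assms by (fastforce simp: prod_map_def PiE_iff)

lemma order_automorphism_ultra_map:
  assumes f: "\<And>i. i \<in> I \<Longrightarrow> order_automorphism (X i) (r i) (f i)"
  shows "order_automorphism (ultraproduct I F X) (ultra_rel I F X r) (ultra_map I F X f)"
proof -
  let ?Y = "ultraproduct I F X" and ?f = "ultra_map I F X f" and ?c = "ultra_class I F X"
  have bij: "bij_betw (f i) (X i) (X i)" if "i \<in> I" for i
    using f[OF that] by (simp add: order_automorphism_def)
  then have im: "f i ` X i \<subseteq> X i" if "i \<in> I" for i
    using that by (simp add: bij_betw_def)
  have map_class: "?f (?c x) = ?c (prod_map I f x)" if "x \<in> PiE I X" for x
    using ultra_map_class[OF ultrafilter im that] .
  have map_in: "prod_map I f x \<in> PiE I X" if "x \<in> PiE I X" for x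
    using prod_map_in[OF im that] .
  \<comment> \<open>Stated for any \<open>P\<close> because it serves both equality (injectivity)
    and \<open>r i\<close> (order).\<close>
  have transfer: "{i\<in>I. P (prod_map I f x i) (prod_map I f y i) i} = {i\<in>I. P (f i (x i)) (f i (y i)) i}"
    for P :: "_ \<Rightarrow> _ \<Rightarrow> _ \<Rightarrow> bool" and x y
    by (auto simp: prod_map_def)
  have inj: "inj_on ?f ?Y"
  proof (rule inj_onI)
    fix C D assume "C \<in> ?Y" "D \<in> ?Y" and eq: "?f C = ?f D"
    then obtain x y where xy: "x \<in> PiE I X" "y \<in> PiE I X" and CD: "C = ?c x" "D = ?c y"
      by (metis ultraproduct_cases)
    have "{i\<in>I. f i (x i) = f i (y i)} \<in> F"
      using eq xy CD map_class class_eq_iff[OF map_in map_in] transfer[of "\<lambda>u v i. u = v"] by auto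
    then have "{i\<in>I. x i = y i} \<in> F"
      by (rule eventually_mono1) (use bij xy in \<open>blast dest: bij_betw_imp_inj_on inj_onD\<close>)
    then show "C = D"
      using class_eq_iff xy CD by blast
  qed
  have surj: "?f ` ?Y = ?Y"
  proof
    show "?f ` ?Y \<subseteq> ?Y"
    proof clarify
      fix C assume "C \<in> ?Y"
      then obtain x where "x \<in> PiE I X" "C = ?c x"
        by (rule ultraproduct_cases)
      then show "?f C \<in> ?Y"
        using map_class map_in ultra_class_in by metis
    qed
    show "?Y \<subseteq> ?f ` ?Y"
    proof
      fix C assume "C \<in> ?Y"
      then obtain y where y: "y \<in> PiE I X" and C: "C = ?c y"
        by (rule ultraproduct_cases)
      \<comment> \<open>A coordinatewise preimage; restricting to \<open>I\<close> makes it
        extensional, hence a point of the product.\<close>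
      define x where "x = (\<lambda>i\<in>I. inv_into (X i) (f i) (y i))"
      have yi: "y i \<in> f i ` X i" if "i \<in> I" for i
        using that y bij[OF that] by (auto simp: bij_betw_def)
      have x: "x \<in> PiE I X"
        using yi by (auto simp: x_def intro: inv_into_into)
      \<comment> \<open>Equality of functions, not merely on a set in \<open>F\<close>: both sides
        are extensional on \<open>I\<close>.\<close>
      have "prod_map I f x = y"
        using yi y by (auto simp: x_def prod_map_def f_inv_into_f PiE_def extensional_def)
      then have "?f (?c x) = C"
        using map_class x C by metis
      then show "C \<in> ?f ` ?Y"
        using ultra_class_in[OF x] by blast
    qed
  qed
  have "(C, D) \<in> ultra_rel I F X r \<longleftrightarrow> (?f C, ?f D) \<in> ultra_rel I F X r" if CD: "C \<in> ?Y" "D \<in> ?Y" for C D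
  proof -
    obtain x y where xy: "x \<in> PiE I X" "y \<in> PiE I X" and CD: "C = ?c x" "D = ?c y"
      using CD by (metis ultraproduct_cases)
    \<comment> \<open>The index sets coincide, so both directions of the order equivalence follow at
      once.\<close>
    have "{i\<in>I. (f i (x i), f i (y i)) \<in> r i} = {i\<in>I. (x i, y i) \<in> r i}"
      using f xy by (fastforce simp: order_automorphism_def dest: PiE_mem)
    then show ?thesis
      using xy CD map_class rel_class_iff rel_class_iff[OF map_in map_in]
        transfer[of "\<lambda>u v i. (u, v) \<in> r i"] by simp
  qed
  then show ?thesis
    using inj surj by (simp add: order_automorphism_def bij_betw_def)
qed

lemma graph_on_ultra_map:
  assumes im: "\<And>i. i \<in> I \<Longrightarrow> f i ` X i \<subseteq> X i"
    and sub: "\<And>i. i \<in> I \<Longrightarrow> graph_on (X i) (f i) \<subseteq> r i"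
  shows "graph_on (ultraproduct I F X) (ultra_map I F X f) \<subseteq> ultra_rel I F X r"
proof
  fix p assume "p \<in> graph_on (ultraproduct I F X) (ultra_map I F X f)"
  then obtain C where C: "C \<in> ultraproduct I F X" and p: "p = (C, ultra_map I F X f C)"
    unfolding graph_on_def by blast
  obtain x where x: "x \<in> PiE I X" and Cx: "C = ultra_class I F X x"
    using C by (rule ultraproduct_cases)
  have "{i\<in>I. (x i, prod_map I f x i) \<in> r i} \<in> F"
  proof (rule all_in)
    fix i assume "i \<in> I"
    then show "(x i, prod_map I f x i) \<in> r i"
      using sub[of i] x by (auto simp: graph_on_def prod_map_def)
  qed
  then show "p \<in> ultra_rel I F X r"
    using rel_class_iff[OF x prod_map_in[OF im x]] ultra_map_class[OF ultrafilter im x] p Cx by simp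
qed

end

section \<open>The ultraproduct as an instance of the frame\<close>

theorem theorem4p5:
  fixes I :: "'i set" and F :: "'i set set" and X :: "'i \<Rightarrow> 'a set"
    and le E :: "'i \<Rightarrow> 'a rel" and \<alpha> :: "'i \<Rightarrow> 'a \<Rightarrow> 'a"
  assumes "ultrafilter_on I F"
    and "\<And>i. i \<in> I \<Longrightarrow> X i \<noteq> {}"
    and "\<And>i. i \<in> I \<Longrightarrow> partial_order_on (X i) (le i)"
    and "\<And>i. i \<in> I \<Longrightarrow> equiv (X i) (E i)"
    and "\<And>i. i \<in> I \<Longrightarrow> le i \<subseteq> E i"
    and "\<And>i. i \<in> I \<Longrightarrow> order_automorphism (X i) (le i) (\<alpha> i)"
    and "\<And>i. i \<in> I \<Longrightarrow> graph_on (X i) (\<alpha> i) \<subseteq> E i"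
  shows
    "let Y = ultraproduct I F X;
         leY = ultra_rel I F X le;
         EY = ultra_rel I F X E;
         \<alpha>Y = ultra_map I F X \<alpha>;
         G = graph_on Y \<alpha>Y
     in partial_order_on Y leY
      \<and> (equiv Y EY \<and> leY \<subseteq> EY)
      \<and> (order_automorphism Y leY \<alpha>Y \<and> G \<subseteq> EY)
      \<and> (G O (EY - leY)\<inverse> = (EY - leY)\<inverse> O G
         \<and> distributive_involutive_FL_algebra (upset_algebra EY leY (G O (EY - leY)\<inverse>)))"
proof -
  interpret ultrafilter I F
    by unfold_locales fact
  have im: "\<alpha> i ` X i \<subseteq> X i" if "i \<in> I" for i
    using assms(6)[OF that] by (simp add: order_automorphism_def bij_betw_def)
  \<comment> \<open>The assumptions of this locale are precisely (i)-(iii); discharging them proves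
    these parts and makes (iv) available.\<close>
  interpret involutive_frame "ultraproduct I F X" "ultra_rel I F X le" "ultra_rel I F X E"
    "ultra_map I F X \<alpha>"
    by unfold_locales
      (intro partial_order_on_ultra_rel equiv_ultra_rel ultra_rel_mono order_automorphism_ultra_map
        graph_on_ultra_map assms im; assumption)+
  show ?thesis
    unfolding Let_def
    using partial_order equiv r_sub_E automorphism graph_sub_E Z_commute
      upset_algebra_involutive[unfolded Z_def]
    by blast
qed

end
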